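(* Let $r\geq 1$ be an integer. For every fixed integer $n\geq 0$ and every $z\in\mathbb{C}$, $$\sum_{m\geq 1}p_{r\text{-}\mathrm{mex}}(m,n)\,z^m = p(n)+(z-1)\sum_{m\geq 0}p\big(n-t_r(m)\big)\,z^m.$$
   Context: For an integer $n\ge 0$, $p(n)$ denotes the number of partitions of $n$, with $p(0)=1$ and $p(n)=0$ for $n<0$; $\mathcal{P}(n)$ is the set of all partitions of $n$. For an integer $r\geq 1$ and a partition $\pi$, $r\text{-}\mathrm{mex}(\pi)$ (the least $r$-gap) is the least positive integer that does not occur at least $r$ times as a part of $\pi$. $p_{r\text{-}\mathrm{mex}}(m,n)$ is the number of partitions $\pi$ of $n$ with $r\text{-}\mathrm{mex}(\pi)=m$. For $m\geq 0$, $t_r(m):=r\cdot\frac{m(m+1)}{2}$. All sums are finite (only finitely many nonzero terms). *)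

theory Defs
  imports "HOL-Analysis.Infinite_Sum" "HOL-Library.Multiset" Complex_Main
begin

text \<open>A partition is the multiset of its (positive) parts, so the empty multiset is the
  unique partition of \<open>0\<close>.\<close>

definition partitions :: "nat \<Rightarrow> nat multiset set" where
  "partitions n = {\<pi>. 0 \<notin># \<pi> \<and> sum_mset \<pi> = n}"

definition num_partitions :: "int \<Rightarrow> nat" where
  "num_partitions k = (if k < 0 then 0 else card (partitions (nat k)))"

definition rmex :: "nat \<Rightarrow> nat multiset \<Rightarrow> nat" where
  "rmex r \<pi> = (LEAST k. 0 < k \<and> \<not> r \<le> count \<pi> k)"

definition p_rmex :: "nat \<Rightarrow> nat \<Rightarrow> nat \<Rightarrow> nat" where
  "p_rmex r m n = card {\<pi> \<in> partitions n. rmex r \<pi> = m}"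

definition tri :: "nat \<Rightarrow> nat \<Rightarrow> nat" where
  "tri r m = r * (m * (m + 1) div 2)"

text \<open>Neither \<^const>\<open>card\<close>, \<^const>\<open>Least\<close> nor \<^const>\<open>infsum\<close> is used below outside its
  intended domain: the sets counted are finite, the minimum exists for \<open>r \<ge> 1\<close>, and the
  summands have finite support.\<close>

lemma finite_partitions: "finite (partitions n)"
proof (rule finite_subset)
  show "finite (mset ` {xs. set xs \<subseteq> {1..n} \<and> length xs \<le> n})"
    by (intro finite_imageI finite_lists_length_le) simp
  show "partitions n \<subseteq> mset ` {xs. set xs \<subseteq> {1..n} \<and> length xs \<le> n}"
  proof
    fix \<pi> assume "\<pi> \<in> partitions n"
    then have pos: "0 \<notin># \<pi>" and sum: "sum_mset \<pi> = n"
      by (auto simp: partitions_def)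
    obtain xs where xs: "\<pi> = mset xs"
      by (metis ex_mset)
    have len: "length ys \<le> sum_list ys" if "0 \<notin> set ys" for ys :: "nat list"
      using that by (induction ys) auto
    have "length xs \<le> n"
      using len[of xs] pos sum by (simp add: xs sum_mset_sum_list)
    moreover have "x \<in> {1..n}" if "x \<in> set xs" for x
    proof -
      have "x \<noteq> 0" using pos that xs by (metis set_mset_mset)
      moreover have "x \<le> n"
        using member_le_sum_list[of x xs] that sum by (simp add: xs sum_mset_sum_list)
      ultimately show ?thesis by simp
    qed
    ultimately show "\<pi> \<in> mset ` {xs. set xs \<subseteq> {1..n} \<and> length xs \<le> n}"
      using xs by blast
  qed
qed

lemma rmex_props:
  assumes "r \<ge> 1"
  shows "0 < rmex r \<pi> \<and> \<not> r \<le> count \<pi> (rmex r \<pi>)"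
proof -
  obtain k where "k \<notin> insert 0 (set_mset \<pi>)"
    by (metis ex_new_if_finite infinite_UNIV_nat finite_insert finite_set_mset)
  then have "0 < k \<and> \<not> r \<le> count \<pi> k"
    using assms by (auto simp: not_in_iff)
  then show ?thesis
    unfolding rmex_def by (rule LeastI)
qed

lemma finite_support_p_rmex: "finite {m. p_rmex r m n \<noteq> 0}"
proof (rule finite_subset)
  show "{m. p_rmex r m n \<noteq> 0} \<subseteq> rmex r ` partitions n"
    unfolding p_rmex_def by (auto simp: card_eq_0_iff)
  show "finite (rmex r ` partitions n)"
    by (intro finite_imageI finite_partitions)
qed

lemma finite_support_num_partitions_tri:
  assumes "r \<ge> 1"
  shows "finite {m. num_partitions (int n - int (tri r m)) \<noteq> 0}"
proof (rule finite_subset)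
  have le: "m \<le> tri r m" for m
  proof -
    have "m * 2 \<le> m * (m + 1)" by (cases m) auto
    then have "m \<le> m * (m + 1) div 2" by linarith
    also have "\<dots> \<le> tri r m" using assms by (simp add: tri_def)
    finally show ?thesis .
  qed
  show "{m. num_partitions (int n - int (tri r m)) \<noteq> 0} \<subseteq> {..n}"
  proof
    fix m assume "m \<in> {m. num_partitions (int n - int (tri r m)) \<noteq> 0}"
    then have "tri r m \<le> n"
      by (simp add: num_partitions_def split: if_splits)
    then show "m \<in> {..n}"
      using le[of m] by simp
  qed
qed simp

end

theory Submission
  imports Defs
begin

text \<open>Summing over partitions, the left-hand side is the sum of \<open>z ^ rmex r \<pi>\<close>, and
  \<open>z ^ M = 1 + (z - 1) * (1 + z + \<dots> + z ^ (M - 1))\<close>. After exchanging the sums, the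
  coefficient of \<open>z ^ m\<close> counts the partitions with \<open>m < rmex r \<pi>\<close>, i.e. those containing
  each of \<open>1, \<dots>, m\<close> at least \<open>r\<close> times; removing \<open>r\<close> copies of each of these parts
  leaves an arbitrary partition of \<open>n - tri r m\<close>.\<close>

text \<open>Adding \<open>\<sigma>\<close> is injective, with removal of \<open>\<sigma>\<close> as
  its inverse, and creates no part 0. If \<open>\<sigma>\<close> sums to more than \<open>n\<close>,
  both sides vanish, the right one by the convention for negative arguments.\<close>

lemma card_partitions_supseteq:
  assumes "0 \<notin># \<sigma>"
  shows "card {\<pi> \<in> partitions n. \<sigma> \<subseteq># \<pi>} = num_partitions (int n - int (sum_mset \<sigma>))"
proof (cases "sum_mset \<sigma> \<le> n")
  case True
  have "{\<pi> \<in> partitions n. \<sigma> \<subseteq># \<pi>} = (+) \<sigma> ` partitions (n - sum_mset \<sigma>)"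
  proof (intro equalityI subsetI)
    fix \<pi> assume "\<pi> \<in> {\<pi> \<in> partitions n. \<sigma> \<subseteq># \<pi>}"
    then obtain \<rho> where "\<pi> = \<sigma> + \<rho>" "\<pi> \<in> partitions n"
      by (auto simp: subset_mset.le_iff_add)
    then show "\<pi> \<in> (+) \<sigma> ` partitions (n - sum_mset \<sigma>)"
      by (auto simp: partitions_def)
  qed (use assms True in \<open>auto simp: partitions_def\<close>)
  then have "card {\<pi> \<in> partitions n. \<sigma> \<subseteq># \<pi>} = card (partitions (n - sum_mset \<sigma>))"
    by (simp add: card_image)
  moreover have "nat (int n - int (sum_mset \<sigma>)) = n - sum_mset \<sigma>"
    by linarith
  ultimately show ?thesis
    using True by (simp add: num_partitions_def del: of_nat_sum_mset)
next
  case False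
  have "\<not> \<sigma> \<subseteq># \<pi>" if "\<pi> \<in> partitions n" for \<pi>
    using that False by (auto simp: partitions_def subset_mset.le_iff_add)
  then show ?thesis
    using False by (simp add: num_partitions_def card_eq_0_iff del: of_nat_sum_mset)
qed

text \<open>The least multiset with \<open>r\<close> copies of each of 1, ..., m: it turns m
  multiplicity conditions into one inclusion.\<close>

definition staircase :: "nat \<Rightarrow> nat \<Rightarrow> nat multiset" where
  "staircase r m = (\<Sum>k\<in>{1..m}. replicate_mset r k)"

lemma count_staircase: "count (staircase r m) k = (if k \<in> {1..m} then r else 0)"
  by (simp add: staircase_def count_sum)

lemma sum_mset_staircase: "sum_mset (staircase r m) = tri r m"
proof -
  have "sum_mset (staircase r m) = r * (\<Sum>k = 1..m. k)"
    by (induction m) (auto simp: staircase_def algebra_simps)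
  also have "(\<Sum>k = 1..m. k) = m * (m + 1) div 2"
    using gauss_sum_from_Suc_0[of m, where 'a = nat] by simp
  finally show ?thesis
    by (simp add: tri_def)
qed

lemma less_rmex_iff:
  assumes "r \<ge> 1"
  shows "m < rmex r \<pi> \<longleftrightarrow> staircase r m \<subseteq># \<pi>"
proof
  assume m: "m < rmex r \<pi>"
  have "r \<le> count \<pi> k" if "k \<in> {1..m}" for k
    using not_less_Least[of k "\<lambda>k. 0 < k \<and> \<not> r \<le> count \<pi> k"] that m
    by (auto simp: rmex_def)
  then show "staircase r m \<subseteq># \<pi>"
    by (auto simp: subseteq_mset_def count_staircase)
next
  assume sub: "staircase r m \<subseteq># \<pi>"
  show "m < rmex r \<pi>"
  proof (rule ccontr)
    assume "\<not> m < rmex r \<pi>"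
    \<comment> \<open>Since \<open>rmex\<close> is positive, it lies in
      \<open>{1..m}\<close>.\<close>
    then have "count (staircase r m) (rmex r \<pi>) = r"
      using rmex_props[OF assms, of \<pi>] by (simp add: count_staircase)
    then have "r \<le> count \<pi> (rmex r \<pi>)"
      using sub by (metis mset_subset_eq_count)
    then show False
      using rmex_props[OF assms, of \<pi>] by simp
  qed
qed

lemma card_less_rmex:
  assumes "r \<ge> 1"
  shows "card {\<pi> \<in> partitions n. m < rmex r \<pi>} = num_partitions (int n - int (tri r m))"
proof -
  have "0 \<notin># staircase r m"
    by (simp add: count_staircase not_in_iff)
  then show ?thesis
    by (simp add: less_rmex_iff[OF assms] card_partitions_supseteq sum_mset_staircase)
qed

text \<open>Only values taken by \<open>rmex\<close> contribute, and grouping the partitions by that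
  value gives the finite sum.\<close>

lemma infsum_p_rmex:
  fixes z :: complex
  assumes "r \<ge> 1"
  shows "(\<Sum>\<^sub>\<infinity>m\<in>{1..}. of_nat (p_rmex r m n) * z ^ m) = (\<Sum>\<pi>\<in>partitions n. z ^ rmex r \<pi>)"
proof -
  let ?R = "rmex r ` partitions n"
  have "?R \<subseteq> {1..}"
    using rmex_props[OF assms] by (auto simp: Suc_le_eq)
  moreover have "p_rmex r m n = 0" if "m \<notin> ?R" for m
    using that by (auto simp: p_rmex_def card_eq_0_iff)
  ultimately have "(\<Sum>\<^sub>\<infinity>m\<in>{1..}. of_nat (p_rmex r m n) * z ^ m)
      = (\<Sum>\<^sub>\<infinity>m\<in>?R. of_nat (p_rmex r m n) * z ^ m)"
    by (intro infsum_cong_neutral) auto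
  also have "\<dots> = (\<Sum>m\<in>?R. of_nat (p_rmex r m n) * z ^ m)"
    by (simp add: finite_partitions)
  also have "\<dots> = (\<Sum>m\<in>?R. \<Sum>\<pi> | \<pi> \<in> partitions n \<and> rmex r \<pi> = m. z ^ rmex r \<pi>)"
    by (simp add: p_rmex_def)
  also have "\<dots> = (\<Sum>\<pi>\<in>partitions n. z ^ rmex r \<pi>)"
    by (rule sum.image_gen[OF finite_partitions, symmetric])
  finally show ?thesis .
qed

lemma infsum_num_partitions_tri:
  fixes z :: complex
  assumes "r \<ge> 1"
  shows "(\<Sum>\<^sub>\<infinity>m\<in>{0..}. of_nat (num_partitions (int n - int (tri r m))) * z ^ m)
    = (\<Sum>\<pi>\<in>partitions n. \<Sum>m<rmex r \<pi>. z ^ m)"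
proof -
  \<comment> \<open>\<open>M\<close> is the support of the coefficients: by
    \<open>card_less_rmex\<close>, the one at \<open>m\<close> counts the partitions with
    \<open>m < rmex r \<pi>\<close>.\<close>
  define M where "M = {m. \<exists>\<pi>\<in>partitions n. m < rmex r \<pi>}"
  have "M = (\<Union>\<pi>\<in>partitions n. {..<rmex r \<pi>})"
    by (auto simp: M_def)
  then have fin: "finite M"
    by (simp add: finite_partitions)
  have "num_partitions (int n - int (tri r m)) = 0" if "m \<notin> M" for m
    using that by (auto simp: M_def card_eq_0_iff simp flip: card_less_rmex[OF assms])
  then have "(\<Sum>\<^sub>\<infinity>m\<in>{0..}. of_nat (num_partitions (int n - int (tri r m))) * z ^ m)
      = (\<Sum>\<^sub>\<infinity>m\<in>M. of_nat (num_partitions (int n - int (tri r m))) * z ^ m)"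
    by (intro infsum_cong_neutral) auto
  \<comment> \<open>Each coefficient is unfolded into a constant sum over the partitions it counts,
    so that the two sums can be exchanged.\<close>
  also have "\<dots> = (\<Sum>m\<in>M. \<Sum>\<pi> | \<pi> \<in> partitions n \<and> m < rmex r \<pi>. z ^ m)"
    using fin by (simp flip: card_less_rmex[OF assms])
  also have "\<dots> = (\<Sum>\<pi>\<in>partitions n. \<Sum>m | m \<in> M \<and> m < rmex r \<pi>. z ^ m)"
    by (rule sum.swap_restrict[OF fin finite_partitions])
  \<comment> \<open>For a partition of \<open>n\<close>, \<open>m < rmex r \<pi>\<close> already
    implies membership in \<open>M\<close>.\<close>
  also have "\<dots> = (\<Sum>\<pi>\<in>partitions n. \<Sum>m<rmex r \<pi>. z ^ m)"
    by (intro sum.cong refl) (auto simp: M_def)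
  finally show ?thesis .
qed

theorem theorem1p1:
  fixes r n :: nat and z :: complex
  assumes "r \<ge> 1"
  shows "(\<Sum>\<^sub>\<infinity>m\<in>{1..}. of_nat (p_rmex r m n) * z ^ m)
       = of_nat (num_partitions (int n))
         + (z - 1) * (\<Sum>\<^sub>\<infinity>m\<in>{0..}. of_nat (num_partitions (int n - int (tri r m))) * z ^ m)"
proof -
  \<comment> \<open>The geometric sum in a division-free form, hence valid at z = 1 too. Summed over
    the partitions, the constant 1 yields p(n).\<close>
  have "z ^ M = 1 + (z - 1) * (\<Sum>m<M. z ^ m)" for M
    using power_diff_1_eq[of z M] by (simp add: algebra_simps)
  then have "(\<Sum>\<pi>\<in>partitions n. z ^ rmex r \<pi>)
      = (\<Sum>\<pi>\<in>partitions n. 1 + (z - 1) * (\<Sum>m<rmex r \<pi>. z ^ m))"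
    by (intro sum.cong refl)
  also have "\<dots> = of_nat (num_partitions (int n))
      + (z - 1) * (\<Sum>\<pi>\<in>partitions n. \<Sum>m<rmex r \<pi>. z ^ m)"
    by (simp add: sum.distrib sum_distrib_left num_partitions_def)
  finally show ?thesis
    by (simp only: infsum_p_rmex[OF assms] infsum_num_partitions_tri[OF assms])
qed

end
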